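(* Let $A\in\bar{\mathcal P}([n])$ and $F\in L(\Gamma(A))$. Then: (1) $\Psi F$ is the unique element of $\mathbb H(\bar{\mathcal P}(A))=\bigoplus_{B\in\bar{\mathcal P}(A)}H_B$ such that $$F=\phi_A\Psi F=\sum_{B\in\bar{\mathcal P}(A)}\phi_A\Psi_BF .$$ (2) For any $A'\in\bar{\mathcal P}(A)$, $$M_{A'}F=\phi_{A'}\Psi F,\qquad\text{or equivalently}\qquad \Psi_BM_{A'}F=\Psi_BF\ \text{ for all } B\in\bar{\mathcal P}(A').$$
   Context: Let $n\ge 1$ and $[n]=\{1,\dots,n\}$. For a finite set $E$: $\mathcal P(E)=\{A\subset E: |A|\ge 2\}$, $\bar{\mathcal P}(E)=\mathcal P(E)\cup\{\emptyset\}$, $L(E)$ is the space of functions $E\to\mathbb R$, $\delta_x$ is the Dirac function at $x$, $\mathbf 1_S$ the indicator of $S$. An injective word on $[n]$ is a finite sequence $\pi=\pi_1\cdots\pi_k$ of distinct elements of $[n]$; its content is $c(\pi)=\{\pi_1,\dots,\pi_k\}$ and its length $|\pi|=k$. The empty word is $\bar 0$, with content $\emptyset$. $\Gamma(A)$ is the set of injective words with content $A$ (so $\Gamma(\emptyset)=\{\bar 0\}$), $\Gamma_n=\bigsqcup_{A\in\mathcal P([n])}\Gamma(A)$, $\bar\Gamma_n=\Gamma_n\cup\{\bar 0\}$. Each $L(\Gamma(A))$ is embedded in $L(\bar\Gamma_n)$ by extension by zero, so $L(\bar\Gamma_n)=\bigoplus_{A\in\bar{\mathcal P}([n])}L(\Gamma(A))$.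 $\pi\subset\sigma$ means that $\pi$ is a (not necessarily contiguous) subword of $\sigma$; $\pi\sqsubset\sigma$ means that $\pi$ is a contiguous subword of $\sigma$. Marginal operators: for $A\in\mathcal P([n])$, $M_A:L(\bar\Gamma_n)\to L(\Gamma(A))$ is $M_AF(\pi)=\sum_{\sigma\in\Gamma_n,\,\pi\subset\sigma}F(\sigma)$; and $M_\emptyset F=\big(\sum_{\pi\in\bar\Gamma_n}F(\pi)\big)\delta_{\bar 0}$. By convention $M_A=M_\emptyset$ if $|A|=1$. Spaces: $H_\emptyset=L(\Gamma(\emptyset))=\mathbb R\delta_{\bar 0}$, and for $B\in\mathcal P([n])$, $H_B=\{F\in L(\Gamma(B)): M_{B'}F=0\text{ for all }B'\subsetneq B\}$. For $\mathcal S\subset\bar{\mathcal P}([n])$, $\mathbb H(\mathcal S)=\bigoplus_{B\in\mathcal S}H_B$, and $\mathbb H_n=\mathbb H(\bar{\mathcal P}([n]))$. Synthesis operators: for $A\in\bar{\mathcal P}([n])$, $\phi_A:L(\bar\Gamma_n)\to L(\Gamma(A))$ is the linear map with $\phi_A\delta_{\bar 0}=\frac1{|A|!}\mathbf 1_{\Gamma(A)}$ and, for $\pi\ne\bar 0$, $\phi_A\delta_\pi=\frac1{(|A|-|\pi|+1)!}\mathbf 1_{\{\sigma\in\Gamma(A):\pi\sqsubset\sigma\}}$ if $c(\pi)\subset A$, and $\phi_A\delta_\pi=0$ otherwise. For $\mathbf X=(X_B)_B\in\mathbb H_n$, $\phi_A\mathbf X=\sum_{B}\phi_AX_B=\sum_{B\in\bar{\mathcal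 P}(A)}\phi_AX_B$. Wavelet transform: for every $A\in\bar{\mathcal P}([n])$ one has $L(\Gamma(A))=\bigoplus_{B\in\bar{\mathcal P}(A)}\phi_A(H_B)$ with $\phi_A$ injective on each $H_B$, $B\in\bar{\mathcal P}(A)$. Hence each $F\in L(\Gamma(A))$ can be written uniquely as $F=\sum_{B\in\bar{\mathcal P}(A)}\phi_A X_B$ with $X_B\in H_B$; one sets $\Psi_BF=X_B$ for $B\in\bar{\mathcal P}(A)$ and $\Psi_BF=0$ for $B\not\subset A$. This is extended linearly to $\Psi_B:L(\bar\Gamma_n)\to H_B$, and $\Psi F=(\Psi_BF)_{B\in\bar{\mathcal P}([n])}\in\mathbb H_n$. *)

theory Defs
  imports
    Complex_Main
    "HOL-Library.Indicator_Function"
    "HOL-Library.Sublist"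
    "HOL-Library.Function_Algebras"
begin

text \<open>
  Words are lists of natural numbers. Subwords are \<^const>\<open>subseq\<close>, contiguous subwords
  are \<^const>\<open>sublist\<close>. Addition, zero and finite sums of functions are pointwise.
\<close>

definition big_subsets :: "nat set \<Rightarrow> nat set set" where
  "big_subsets E = {A. A \<subseteq> E \<and> 2 \<le> card A}"

definition big_subsets0 :: "nat set \<Rightarrow> nat set set" where
  "big_subsets0 E = big_subsets E \<union> {{}}"

definition inj_words :: "nat set \<Rightarrow> nat list set" where
  "inj_words A = {\<pi>. distinct \<pi> \<and> set \<pi> = A}"

definition Gamma_n :: "nat \<Rightarrow> nat list set" where
  "Gamma_n n = (\<Union>A\<in>big_subsets {1..n}. inj_words A)"

definition Gamma0_n :: "nat \<Rightarrow> nat list set" where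
  "Gamma0_n n = Gamma_n n \<union> {[]}"

text \<open>
  Functions on a set of words are represented by their extension by zero to all words,
  so that the embedding of the functions on \<open>inj_words A\<close> into those on \<open>Gamma0_n n\<close> is
  set inclusion.
\<close>

definition L :: "nat list set \<Rightarrow> (nat list \<Rightarrow> real) set" where
  "L E = {F. \<forall>\<pi>. \<pi> \<notin> E \<longrightarrow> F \<pi> = 0}"

definition restr :: "nat list set \<Rightarrow> (nat list \<Rightarrow> real) \<Rightarrow> nat list \<Rightarrow> real" where
  "restr E F = (\<lambda>\<pi>. if \<pi> \<in> E then F \<pi> else 0)"

text \<open>The second branch covers the empty set and, by convention, singletons.\<close>

definition marginal :: "nat \<Rightarrow> nat set \<Rightarrow> (nat list \<Rightarrow> real) \<Rightarrow> nat list \<Rightarrow> real" where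
  "marginal n A F =
     (if 2 \<le> card A
      then (\<lambda>\<pi>. if \<pi> \<in> inj_words A then (\<Sum>\<sigma> \<in> {\<sigma> \<in> Gamma_n n. subseq \<pi> \<sigma>}. F \<sigma>) else 0)
      else (\<lambda>\<pi>. if \<pi> = [] then (\<Sum>\<sigma> \<in> Gamma0_n n. F \<sigma>) else 0))"

definition H :: "nat \<Rightarrow> nat set \<Rightarrow> (nat list \<Rightarrow> real) set" where
  "H n B =
     (if B = {} then L (inj_words {})
      else {F \<in> L (inj_words B). \<forall>B'. B' \<subset> B \<longrightarrow> marginal n B' F = 0})"

text \<open>Elements of the direct sum over \<open>S\<close> are families that vanish at indices outside \<open>S\<close>.\<close>

definition HH :: "nat \<Rightarrow> nat set set \<Rightarrow> (nat set \<Rightarrow> nat list \<Rightarrow> real) set" where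
  "HH n S = {X. (\<forall>B\<in>S. X B \<in> H n B) \<and> (\<forall>B. B \<notin> S \<longrightarrow> X B = 0)}"

definition phi_dirac :: "nat set \<Rightarrow> nat list \<Rightarrow> nat list \<Rightarrow> real" where
  "phi_dirac A \<pi> =
     (if \<pi> = [] then (\<lambda>\<sigma>. 1 / fact (card A) * indicator (inj_words A) \<sigma>)
      else if set \<pi> \<subseteq> A then
        (\<lambda>\<sigma>. 1 / fact (card A - length \<pi> + 1) * indicator {\<tau> \<in> inj_words A. sublist \<pi> \<tau>} \<sigma>)
      else 0)"

definition phi :: "nat \<Rightarrow> nat set \<Rightarrow> (nat list \<Rightarrow> real) \<Rightarrow> nat list \<Rightarrow> real" where
  "phi n A F = (\<lambda>\<sigma>. \<Sum>\<pi>\<in>Gamma0_n n. F \<pi> * phi_dirac A \<pi> \<sigma>)"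

definition phi_fam :: "nat \<Rightarrow> nat set \<Rightarrow> (nat set \<Rightarrow> nat list \<Rightarrow> real) \<Rightarrow> nat list \<Rightarrow> real" where
  "phi_fam n A X = (\<Sum>B\<in>big_subsets0 {1..n}. phi n A (X B))"

text \<open>
  The description operator is meaningful because every function on \<open>inj_words A\<close> has exactly
  one such decomposition; this fact is not assumed anywhere. \<open>Psi\<close> is the linear extension,
  applying \<open>Psi_on n A\<close> to the component of \<open>F\<close> in the summand \<open>inj_words A\<close>.
\<close>

definition Psi_on ::
  "nat \<Rightarrow> nat set \<Rightarrow> (nat list \<Rightarrow> real) \<Rightarrow> nat set \<Rightarrow> nat list \<Rightarrow> real" where
  "Psi_on n A F B =
     (if B \<in> big_subsets0 A
      then (THE X. X \<in> HH n (big_subsets0 A) \<and> F = (\<Sum>C\<in>big_subsets0 A. phi n A (X C))) B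
      else 0)"

definition Psi :: "nat \<Rightarrow> (nat list \<Rightarrow> real) \<Rightarrow> nat set \<Rightarrow> nat list \<Rightarrow> real" where
  "Psi n F B = (\<Sum>A\<in>big_subsets0 {1..n}. Psi_on n A (restr (inj_words A) F) B)"

end

theory Submission imports Defs begin

text \<open>
  Everything rests on one identity: taking marginals commutes with synthesis. For \<open>X \<in> H n B\<close>
  and \<open>A' \<subseteq> A\<close>, the marginal on \<open>A'\<close> of \<open>phi n A X\<close> is \<open>phi n A' X\<close>, which is zero unless
  \<open>B \<subseteq> A'\<close> (lemma \<open>push_phi\<close>).

  On functions on \<open>inj_words A\<close> the marginal on \<open>A'\<close> is the push-forward along the map that erases
  the letters outside \<open>A'\<close> (lemma \<open>marginal_eq_push\<close>). Push-forwards compose, so the identity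
  has to be checked only when a single letter \<open>a\<close> is erased; the preimages of a word \<open>s\<close> are then
  the \<open>length s + 1\<close> ways of inserting \<open>a\<close> into \<open>s\<close>. If \<open>a \<notin> B\<close>, the insertions that
  do not break a given nonempty factor \<open>\<pi>\<close> of \<open>s\<close> number \<open>card A - card B + 1\<close>, which is what
  turns the normalising factorial of \<open>A\<close> into the one of \<open>A - {a}\<close>; for the empty word all \<open>card A\<close>
  insertions count, against the normalisation \<open>fact (card A)\<close>. If \<open>a \<in> B\<close>, a word \<open>\<pi>\<close> with content
  \<open>B\<close> is a factor of an insertion, necessarily a unique one, exactly when \<open>\<pi>\<close> without \<open>a\<close> is a
  factor of \<open>s\<close>. The sum over all \<open>\<pi>\<close> is therefore a combination of values of the marginal of
  \<open>X\<close> on \<open>B - {a}\<close>, and these vanish because \<open>X \<in> H n B\<close>.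

  Given the identity, the marginals of \<open>F = (\<Sum>C\<in>big_subsets0 A. phi n A (X C))\<close> form the system
  \<open>push A B F = (\<Sum>C\<in>big_subsets0 B. phi n B (X C))\<close>, indexed by the \<open>B\<close> in \<open>big_subsets0 A\<close>.
  It is triangular for inclusion with identity diagonal, as \<open>phi n B (X B) = X B\<close>. Its
  solution is thus unique (\<open>decomposition_unique\<close>), and can be written down by recursion on \<open>B\<close>
  for every \<open>F\<close> (\<open>wavelet\<close>). The equations for \<open>B' \<subset> B\<close> are precisely what makes the proper
  marginals of the \<open>B\<close>-component vanish, so the recursive solution lies in the spaces \<open>H n B\<close>
  (\<open>wavelet_in_H\<close>), and the equation for \<open>B = A\<close> is the decomposition of \<open>F\<close>. Hence \<open>Psi n F\<close>
  is this solution, and the other equations of the same system are the second half of the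
  theorem.
\<close>

section \<open>Words and insertions of a letter\<close>

lemma finite_inj_words: "finite A \<Longrightarrow> finite (inj_words A)"
  unfolding inj_words_def
  by (rule finite_subset[OF _ finite_lists_length_le[of A "card A"]])
     (auto simp: distinct_card)

lemma inj_words_empty [simp]: "inj_words {} = {[]}"
  by (auto simp: inj_words_def)

lemma length_inj_words: "\<pi> \<in> inj_words A \<Longrightarrow> length \<pi> = card A"
  by (auto simp: inj_words_def distinct_card)

lemma filter_inj_words:
  assumes "A' \<subseteq> A" "\<sigma> \<in> inj_words A"
  shows "filter (\<lambda>x. x \<in> A') \<sigma> \<in> inj_words A'"
  using assms by (auto simp: inj_words_def)

lemma filter_eq_removeAll:
  assumes "\<sigma> \<in> inj_words A"
  shows "filter (\<lambda>x. x \<in> A - {a}) \<sigma> = removeAll a \<sigma>"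
  using assms by (auto simp: inj_words_def removeAll_filter_not_eq intro!: filter_cong)

text \<open>
  The letters of \<open>\<pi>\<close> occur only once in \<open>\<sigma>\<close>, so there is just one way to embed \<open>\<pi>\<close>. This turns
  the subword relation, which defines marginals, into the graph of a map.
\<close>

lemma subseq_iff_filter:
  assumes "\<pi> \<in> inj_words B" "distinct \<sigma>"
  shows "subseq \<pi> \<sigma> \<longleftrightarrow> filter (\<lambda>x. x \<in> B) \<sigma> = \<pi>"
proof
  assume "filter (\<lambda>x. x \<in> B) \<sigma> = \<pi>"
  then show "subseq \<pi> \<sigma>" using subseq_filter_left by blast
next
  assume s: "subseq \<pi> \<sigma>"
  have B: "set \<pi> = B" and d: "distinct \<pi>" using assms by (auto simp: inj_words_def)
  have "filter (\<lambda>x. x \<in> B) \<pi> = \<pi>" using B by (simp add: filter_id_conv)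
  then have ss: "subseq \<pi> (filter (\<lambda>x. x \<in> B) \<sigma>)"
    using subseq_filter[OF s, of "\<lambda>x. x \<in> B"] by simp
  have "length (filter (\<lambda>x. x \<in> B) \<sigma>) = card (set \<sigma> \<inter> B)"
    using assms(2) by (metis distinct_card distinct_filter inter_set_filter Int_commute)
  also have "\<dots> \<le> card B" using B by (auto intro: card_mono)
  also have "\<dots> = length \<pi>" using B d by (simp add: distinct_card[symmetric])
  finally show "filter (\<lambda>x. x \<in> B) \<sigma> = \<pi>"
    using ss list_emb_length[OF ss] subseq_same_length by fastforce
qed

text \<open>The first letter of \<open>p\<close> occurs once and so fixes the position of \<open>p\<close>.\<close>

lemma distinct_factor_unique:
  assumes "distinct (u @ p @ v)" "u @ p @ v = x @ p @ y" "p \<noteq> []"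
  shows "u = x \<and> v = y"
proof -
  obtain c q where p: "p = c # q" using assms(3) by (cases p) auto
  have "distinct (x @ p @ y)" using assms(1,2) by metis
  then have "c \<notin> set x" "c \<notin> set q" "c \<notin> set y" using p by auto
  moreover have "c \<notin> set u" "c \<notin> set v" using assms(1) p by auto
  moreover have "u @ c # q @ v = x @ c # q @ y" using assms(2) p by simp
  ultimately have "u = x \<and> q @ v = q @ y"
    using append_Cons_eq_iff[of c u "q @ v" x "q @ y"] by simp
  then show ?thesis by simp
qed

definition insertions :: "nat \<Rightarrow> nat list \<Rightarrow> nat list set" where
  "insertions a s = {x. distinct x \<and> a \<in> set x \<and> removeAll a x = s}"

text \<open>
  Parametrising the insertions by their position gives their number; the definition by
  erasure is the one that matches the fibres of push-forwards.
\<close>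

lemma insertions_image:
  assumes "distinct s" "a \<notin> set s"
  shows "insertions a s = (\<lambda>i. take i s @ a # drop i s) ` {..length s}"
proof (intro equalityI subsetI)
  fix x assume "x \<in> insertions a s"
  then have x: "distinct x" "a \<in> set x" "removeAll a x = s" by (auto simp: insertions_def)
  obtain y z where yz: "x = y @ a # z" using x(2) by (meson split_list)
  then have "s = y @ z" using x by auto
  then have "x = take (length y) s @ a # drop (length y) s" "length y \<le> length s"
    using yz by auto
  then show "x \<in> (\<lambda>i. take i s @ a # drop i s) ` {..length s}" by blast
next
  fix x assume "x \<in> (\<lambda>i. take i s @ a # drop i s) ` {..length s}"
  then obtain i where x: "x = take i s @ a # drop i s" by blast
  have s: "set (take i s) \<subseteq> set s" "set (drop i s) \<subseteq> set s"
    by (auto dest: in_set_takeD in_set_dropD)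
  have n: "a \<notin> set (take i s)" "a \<notin> set (drop i s)" using s assms by auto
  have "set (take i s) \<inter> set (drop i s) = {}"
    using assms(1) by (simp add: set_take_disj_set_drop_if_distinct)
  then have "distinct x" using x n assms by auto
  moreover have "removeAll a x = s" using x n by (simp add: removeAll_id)
  ultimately show "x \<in> insertions a s" using x by (simp add: insertions_def)
qed

lemma card_insertions:
  assumes "distinct s" "a \<notin> set s"
  shows "card (insertions a s) = length s + 1"
proof -
  have n: "a \<notin> set (take i s)" "a \<notin> set (drop i s)" for i
    using assms by (auto dest: in_set_takeD in_set_dropD)
  have "inj_on (\<lambda>i. take i s @ a # drop i s) {..length s}"
  proof (rule inj_onI)
    fix i j assume ij: "i \<in> {..length s}" "j \<in> {..length s}"
      and e: "take i s @ a # drop i s = take j s @ a # drop j s"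
    have "take i s = take j s"
      using e n append_Cons_eq_iff[of a "take i s" "drop i s" "take j s" "drop j s"] by auto
    then have "length (take i s) = length (take j s)" by simp
    then show "i = j" using ij by simp
  qed
  then show ?thesis by (simp add: insertions_image[OF assms] card_image)
qed

lemma finite_insertions: "distinct s \<Longrightarrow> a \<notin> set s \<Longrightarrow> finite (insertions a s)"
  by (simp add: insertions_image)

lemma inj_words_removeAll_fibre:
  assumes "\<sigma>' \<in> inj_words (A - {a})" "a \<in> A"
  shows "{\<sigma> \<in> inj_words A. filter (\<lambda>x. x \<in> A - {a}) \<sigma> = \<sigma>'} = insertions a \<sigma>'"
proof -
  have "{\<sigma> \<in> inj_words A. filter (\<lambda>x. x \<in> A - {a}) \<sigma> = \<sigma>'}
      = {\<sigma> \<in> inj_words A. removeAll a \<sigma> = \<sigma>'}"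
    by (intro Collect_cong conj_cong refl) (simp only: filter_eq_removeAll)
  also have "\<dots> = insertions a \<sigma>'"
  proof -
    have "set \<sigma> = A \<longleftrightarrow> a \<in> set \<sigma>" if "removeAll a \<sigma> = \<sigma>'" for \<sigma>
    proof -
      have "set \<sigma> - {a} = A - {a}"
        using assms(1) that by (metis (lifting) inj_words_def mem_Collect_eq set_removeAll)
      then show ?thesis using assms(2) by blast
    qed
    then show ?thesis unfolding inj_words_def insertions_def by blast
  qed
  finally show ?thesis .
qed

text \<open>
  If \<open>s = u @ p @ v\<close>, inserting \<open>a\<close> keeps \<open>p\<close> contiguous iff \<open>a\<close> goes into \<open>u\<close> or into \<open>v\<close>,
  which gives \<open>(length u + 1) + (length v + 1)\<close> possibilities. Conversely, erasing \<open>a\<close> leaves a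
  factor without \<open>a\<close> intact.
\<close>

lemma card_insertions_avoiding_factor:
  assumes s: "distinct s" "a \<notin> set s" and p: "a \<notin> set p" "p \<noteq> []"
  shows "card {x \<in> insertions a s. sublist p x}
       = (if sublist p s then length s - length p + 2 else 0)"
proof (cases "sublist p s")
  case True
  then obtain u v where uv: "s = u @ p @ v" by (auto simp: sublist_def)
  let ?U = "(\<lambda>x. x @ p @ v) ` insertions a u" and ?V = "(\<lambda>y. u @ p @ y) ` insertions a v"
  have du: "distinct u" "a \<notin> set u" and dv: "distinct v" "a \<notin> set v"
    using s uv by auto
  have "{x \<in> insertions a s. sublist p x} = ?U \<union> ?V"
  proof (intro equalityI subsetI)
    fix w assume "w \<in> {x \<in> insertions a s. sublist p x}"
    then obtain x y where w: "w = x @ p @ y" and d: "distinct w" and aw: "a \<in> set w"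
      and r: "removeAll a w = s"
      by (auto simp: insertions_def sublist_def)
    have "u @ p @ v = removeAll a x @ p @ removeAll a y"
      using r w uv p(1) by (simp add: removeAll_id)
    then have xy: "removeAll a x = u" "removeAll a y = v"
      using distinct_factor_unique[of u p v "removeAll a x" "removeAll a y"] s(1) p(2)
      unfolding uv by blast+
    consider "a \<in> set x" "a \<notin> set y" | "a \<in> set y" "a \<notin> set x"
      using aw d w p(1) by auto
    then show "w \<in> ?U \<union> ?V"
    proof cases
      case 1
      then have "x \<in> insertions a u" "y = v" using xy d w by (auto simp: insertions_def removeAll_id)
      then show ?thesis using w by blast
    next
      case 2
      then have "y \<in> insertions a v" "x = u" using xy d w by (auto simp: insertions_def removeAll_id)
      then show ?thesis using w by blast
    qed
  next
    fix w assume "w \<in> ?U \<union> ?V"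
    then consider x where "x \<in> insertions a u" "w = x @ p @ v"
      | y where "y \<in> insertions a v" "w = u @ p @ y" by blast
    then show "w \<in> {x \<in> insertions a s. sublist p x}"
    proof cases
      case 1
      then have x: "distinct x" "a \<in> set x" "removeAll a x = u" by (auto simp: insertions_def)
      then have "set x \<subseteq> insert a (set u)" by auto
      then have "distinct w" using x(1) 1(2) s p dv unfolding uv by auto
      moreover have "removeAll a w = s" using 1(2) x(3) p dv uv by (simp add: removeAll_id)
      ultimately show ?thesis using 1(2) x(2) by (simp add: insertions_def)
    next
      case 2
      then have y: "distinct y" "a \<in> set y" "removeAll a y = v" by (auto simp: insertions_def)
      then have "set y \<subseteq> insert a (set v)" by auto
      then have "distinct w" using y(1) 2(2) s p du unfolding uv by auto
      moreover have "removeAll a w = s" using 2(2) y(3) p du uv by (simp add: removeAll_id)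
      ultimately show ?thesis using 2(2) y(2) by (simp add: insertions_def)
    qed
  qed
  moreover have "?U \<inter> ?V = {}"
  proof -
    have False if "x \<in> insertions a u" "y \<in> insertions a v" "x @ p @ v = u @ p @ y" for x y
    proof -
      have "set x \<subseteq> insert a (set u)" using that by (auto simp: insertions_def)
      then have "distinct (x @ p @ v)" using that(1) s p dv unfolding uv by (auto simp: insertions_def)
      then have "x = u" using distinct_factor_unique[of x p v u y] that(3) p(2) by blast
      then show False using that(1) du by (auto simp: insertions_def)
    qed
    then show ?thesis by blast
  qed
  moreover have "card ?U = length u + 1" "card ?V = length v + 1"
    using card_insertions[OF du] card_insertions[OF dv] by (auto simp: card_image inj_on_def)
  moreover have "finite ?U" "finite ?V" using finite_insertions du dv by auto
  ultimately have "card {x \<in> insertions a s. sublist p x} = length u + 1 + (length v + 1)"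
    by (simp add: card_Un_disjoint)
  then show ?thesis using True uv by simp
next
  case False
  have "\<not> sublist p w" if w: "w \<in> insertions a s" for w
  proof
    assume "sublist p w"
    then obtain x y where "w = x @ p @ y" by (auto simp: sublist_def)
    then have "s = removeAll a x @ p @ removeAll a y"
      using w p(1) by (simp add: insertions_def removeAll_id)
    then show False using False by (auto simp: sublist_def)
  qed
  then have "{x \<in> insertions a s. sublist p x} = {}" by blast
  then have "card {x \<in> insertions a s. sublist p x} = 0" by (simp only: card.empty)
  then show ?thesis using False by simp
qed

text \<open>
  Here the factor \<open>p\<close> prescribes the place of \<open>a\<close>: the only candidate is \<open>s\<close> with its factor
  \<open>removeAll a p\<close> replaced by \<open>p\<close>. If \<open>removeAll a p\<close> were empty, every insertion would contain
  \<open>p = [a]\<close>.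
\<close>

lemma card_insertions_containing_factor:
  assumes s: "distinct s" "a \<notin> set s"
    and p: "a \<in> set p" "distinct p" "removeAll a p \<noteq> []"
  shows "card {x \<in> insertions a s. sublist p x} = (if sublist (removeAll a p) s then 1 else 0)"
proof -
  have dec: "\<exists>x y. w = x @ p @ y \<and> s = x @ removeAll a p @ y"
    if w: "w \<in> insertions a s" "sublist p w" for w
  proof -
    obtain x y where xy: "w = x @ p @ y" using w(2) by (auto simp: sublist_def)
    then have "a \<notin> set x" "a \<notin> set y" using w(1) p(1) by (auto simp: insertions_def)
    then have "s = x @ removeAll a p @ y" using w(1) xy by (auto simp: insertions_def removeAll_id)
    then show ?thesis using xy by blast
  qed
  show ?thesis
  proof (cases "sublist (removeAll a p) s")
    case True
    then obtain u v where uv: "s = u @ removeAll a p @ v" by (auto simp: sublist_def)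
    have "{x \<in> insertions a s. sublist p x} = {u @ p @ v}"
    proof (intro equalityI subsetI)
      fix w assume "w \<in> {x \<in> insertions a s. sublist p x}"
      then obtain x y where "w = x @ p @ y" "s = x @ removeAll a p @ y" using dec by blast
      then show "w \<in> {u @ p @ v}"
        using distinct_factor_unique[of u "removeAll a p" v x y] s(1) p(3) unfolding uv by blast
    next
      fix w assume "w \<in> {u @ p @ v}"
      then show "w \<in> {x \<in> insertions a s. sublist p x}"
        using s p unfolding uv by (auto simp: insertions_def removeAll_id)
    qed
    then show ?thesis using True by simp
  next
    case False
    then have "{x \<in> insertions a s. sublist p x} = {}" using dec sublist_appendI by fastforce
    then have "card {x \<in> insertions a s. sublist p x} = 0" by (simp only: card.empty)
    then show ?thesis using False by simp
  qed
qed

section \<open>Marginals as push-forwards\<close>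

text \<open>
  In contrast to \<open>marginal\<close>, this makes no exception for singletons, so that letters can be erased
  one at a time down to the empty word. In addition, the set \<open>A\<close> carrying \<open>F\<close> is explicit, and
  no bound \<open>n\<close> is involved.
\<close>

definition push :: "nat set \<Rightarrow> nat set \<Rightarrow> (nat list \<Rightarrow> real) \<Rightarrow> nat list \<Rightarrow> real" where
  "push A A' F = (\<lambda>\<pi>. \<Sum>\<sigma> | \<sigma> \<in> inj_words A \<and> filter (\<lambda>x. x \<in> A') \<sigma> = \<pi>. F \<sigma>)"

lemma push_in_L:
  assumes "A' \<subseteq> A"
  shows "push A A' F \<in> L (inj_words A')"
proof -
  have "push A A' F \<pi> = 0" if "\<pi> \<notin> inj_words A'" for \<pi>
  proof -
    have "{\<sigma>. \<sigma> \<in> inj_words A \<and> filter (\<lambda>x. x \<in> A') \<sigma> = \<pi>} = {}"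
      using filter_inj_words[OF assms] that by blast
    then show ?thesis unfolding push_def by (simp only: sum.empty)
  qed
  then show ?thesis by (simp add: L_def)
qed

lemma push_self:
  assumes "F \<in> L (inj_words A)"
  shows "push A A F = F"
proof
  fix \<pi>
  have "{\<sigma>. \<sigma> \<in> inj_words A \<and> filter (\<lambda>x. x \<in> A) \<sigma> = \<pi>} = (if \<pi> \<in> inj_words A then {\<pi>} else {})"
  proof -
    have "filter (\<lambda>x. x \<in> A) \<sigma> = \<sigma>" if "\<sigma> \<in> inj_words A" for \<sigma>
      using that by (auto simp: inj_words_def filter_id_conv)
    then show ?thesis by auto
  qed
  then show "push A A F \<pi> = F \<pi>" using assms by (auto simp: push_def L_def)
qed

lemma push_push:
  assumes "finite A" "A'' \<subseteq> A'" "A' \<subseteq> A"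
  shows "push A' A'' (push A A' F) = push A A'' F"
proof
  fix \<pi>
  let ?T = "{\<tau>. \<tau> \<in> inj_words A' \<and> filter (\<lambda>x. x \<in> A'') \<tau> = \<pi>}"
  let ?S = "{\<sigma>. \<sigma> \<in> inj_words A \<and> filter (\<lambda>x. x \<in> A'') \<sigma> = \<pi>}"
  let ?g = "filter (\<lambda>x. x \<in> A')"
  have ff: "filter (\<lambda>x. x \<in> A'') (?g \<sigma>) = filter (\<lambda>x. x \<in> A'') \<sigma>" for \<sigma>
    using assms(2) by (auto intro!: filter_cong)
  have fin: "finite ?S" "finite ?T"
    using finite_inj_words[OF assms(1)] finite_inj_words[OF finite_subset[OF assms(3,1)]] by simp_all
  have "?g ` ?S \<subseteq> ?T" using ff filter_inj_words[OF assms(3)] by auto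
  then have "sum F ?S = (\<Sum>\<tau>\<in>?T. sum F {\<sigma> \<in> ?S. ?g \<sigma> = \<tau>})"
    using sum.group[OF fin, of ?g F] by simp
  also have "\<dots> = (\<Sum>\<tau>\<in>?T. push A A' F \<tau>)"
    unfolding push_def
  proof (intro sum.cong refl)
    fix \<tau> assume "\<tau> \<in> ?T"
    then show "{\<sigma> \<in> ?S. ?g \<sigma> = \<tau>} = {\<sigma>. \<sigma> \<in> inj_words A \<and> ?g \<sigma> = \<tau>}" using ff by auto
  qed
  finally show "push A' A'' (push A A' F) \<pi> = push A A'' F \<pi>" by (simp add: push_def)
qed

lemma push_diff: "push A A' (F - G) = push A A' F - push A A' G"
  by (simp add: push_def fun_eq_iff sum_subtractf)

lemma sum_fun_apply: "(sum f S) x = (\<Sum>i\<in>S. f i x)"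
  by (induction S rule: infinite_finite_induct) auto

lemma push_sum: "push A A' (\<Sum>i\<in>S. F i) = (\<Sum>i\<in>S. push A A' (F i))"
proof
  fix \<pi>
  show "push A A' (\<Sum>i\<in>S. F i) \<pi> = (\<Sum>i\<in>S. push A A' (F i)) \<pi>"
    unfolding push_def sum_fun_apply by (rule sum.swap)
qed

lemma push_0: "push A A' 0 = 0"
  by (simp add: push_def fun_eq_iff)

lemma finite_Gamma0: "finite (Gamma0_n n)"
proof -
  have "finite (big_subsets {1..n})" by (auto simp: big_subsets_def)
  moreover have "finite (inj_words A)" if "A \<in> big_subsets {1..n}" for A
    using that finite_inj_words finite_subset[of A "{1..n}"] by (auto simp: big_subsets_def)
  ultimately show ?thesis by (auto simp: Gamma0_n_def Gamma_n_def)
qed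

lemma finite_big_subsets0: "finite E \<Longrightarrow> finite (big_subsets0 E)"
  by (auto simp: big_subsets0_def big_subsets_def)

lemma big_subsets0_subset: "A \<in> big_subsets0 E \<Longrightarrow> A \<subseteq> E"
  by (auto simp: big_subsets0_def big_subsets_def)

lemma big_subsets0_mono: "A \<subseteq> E \<Longrightarrow> big_subsets0 A \<subseteq> big_subsets0 E"
  by (auto simp: big_subsets0_def big_subsets_def)

lemma finite_big_subsets0_member: "A \<in> big_subsets0 {1..n} \<Longrightarrow> finite A"
  using big_subsets0_subset finite_subset by blast

lemma inj_words_subset_Gamma0:
  "A \<in> big_subsets0 {1..n} \<Longrightarrow> inj_words A \<subseteq> Gamma0_n n"
  by (auto simp: Gamma0_n_def Gamma_n_def big_subsets0_def)

text \<open>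
  For \<open>A' = {}\<close> all words are erased to the empty word, and the push-forward is the total mass.
\<close>

lemma marginal_eq_push:
  assumes A: "A \<in> big_subsets0 {1..n}" and A': "A' \<in> big_subsets0 A"
    and F: "F \<in> L (inj_words A)"
  shows "marginal n A' F = push A A' F"
proof (cases "2 \<le> card A'")
  case True
  have fA: "finite A" using A by (rule finite_big_subsets0_member)
  have sub: "A' \<subseteq> A" using A' by (rule big_subsets0_subset)
  have "2 \<le> card A" using True card_mono[OF fA sub] by simp
  then have "A \<in> big_subsets {1..n}" using A by (auto simp: big_subsets0_def)
  then have G: "inj_words A \<subseteq> Gamma_n n" by (auto simp: Gamma_n_def)
  have fG: "finite (Gamma_n n)" using finite_Gamma0[of n] by (simp add: Gamma0_n_def)
  have "marginal n A' F \<pi> = push A A' F \<pi>" for \<pi>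
  proof (cases "\<pi> \<in> inj_words A'")
    case p: True
    have "(\<Sum>\<sigma> \<in> {\<sigma> \<in> Gamma_n n. subseq \<pi> \<sigma>}. F \<sigma>)
        = (\<Sum>\<sigma> | \<sigma> \<in> inj_words A \<and> filter (\<lambda>x. x \<in> A') \<sigma> = \<pi>. F \<sigma>)"
    proof (rule sum.mono_neutral_right)
      show "{\<sigma>. \<sigma> \<in> inj_words A \<and> filter (\<lambda>x. x \<in> A') \<sigma> = \<pi>} \<subseteq> {\<sigma> \<in> Gamma_n n. subseq \<pi> \<sigma>}"
        using G subseq_iff_filter[OF p] by (auto simp: inj_words_def)
      show "\<forall>\<sigma>\<in>{\<sigma> \<in> Gamma_n n. subseq \<pi> \<sigma>} -
          {\<sigma>. \<sigma> \<in> inj_words A \<and> filter (\<lambda>x. x \<in> A') \<sigma> = \<pi>}. F \<sigma> = 0"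
      proof
        fix \<sigma> assume "\<sigma> \<in> {\<sigma> \<in> Gamma_n n. subseq \<pi> \<sigma>} -
          {\<sigma>. \<sigma> \<in> inj_words A \<and> filter (\<lambda>x. x \<in> A') \<sigma> = \<pi>}"
        moreover from this have "\<sigma> \<notin> inj_words A"
          using subseq_iff_filter[OF p] by (auto simp: inj_words_def)
        ultimately show "F \<sigma> = 0" using F by (simp add: L_def)
      qed
    qed (use fG in auto)
    then show ?thesis using True p by (simp add: marginal_def push_def)
  next
    case False
    then show ?thesis using True push_in_L[OF sub] by (simp add: marginal_def L_def)
  qed
  then show ?thesis by blast
next
  case False
  then have e: "A' = {}" using A' by (auto simp: big_subsets0_def big_subsets_def)
  have "(\<Sum>\<sigma> \<in> Gamma0_n n. F \<sigma>) = (\<Sum>\<sigma> \<in> inj_words A. F \<sigma>)"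
    using F by (intro sum.mono_neutral_right finite_Gamma0 inj_words_subset_Gamma0[OF A])
      (auto simp: L_def)
  then show ?thesis by (auto simp: marginal_def push_def e fun_eq_iff)
qed

lemma H_imp_L: "X \<in> H n B \<Longrightarrow> X \<in> L (inj_words B)"
  by (auto simp: H_def split: if_splits)

lemma marginal_small:
  "card B' < 2 \<Longrightarrow> marginal n B' F = marginal n {} F"
  by (simp add: marginal_def)

text \<open>
  For singletons \<open>B' = {b}\<close> the convention for \<open>marginal\<close> and the push-forward differ only in the
  word, \<open>[]\<close> or \<open>[b]\<close>, that carries the total mass, so both vanish together.
\<close>

lemma push_H_eq_0:
  assumes B: "B \<in> big_subsets0 {1..n}" and X: "X \<in> H n B" and sub: "B' \<subset> B"
  shows "push B B' X = 0"
proof -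
  have fB: "finite B" using B by (rule finite_big_subsets0_member)
  have ne: "B \<noteq> {}" using sub by blast
  have L: "X \<in> L (inj_words B)" and m: "\<And>C. C \<subset> B \<Longrightarrow> marginal n C X = 0"
    using X ne by (auto simp: H_def)
  show ?thesis
  proof (cases "B' \<in> big_subsets0 B")
    case True
    then show ?thesis using marginal_eq_push[OF B True L] m[OF sub] by simp
  next
    case False
    then have "B' \<noteq> {}" "card B' < 2" using sub by (auto simp: big_subsets0_def big_subsets_def)
    moreover have "finite B'" using sub fB finite_subset by blast
    ultimately have "card B' = 1" using card_gt_0_iff[of B'] by linarith
    then obtain b where b: "B' = {b}" by (auto simp: card_Suc_eq)
    have "{} \<in> big_subsets0 B" by (simp add: big_subsets0_def)
    then have "push B {} X = 0" using marginal_eq_push[OF B _ L] m[of "{}"] ne by auto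
    then have t: "(\<Sum>\<sigma>\<in>inj_words B. X \<sigma>) = 0"
      by (auto simp: push_def dest!: fun_cong[of _ _ "[]"])
    show ?thesis
    proof
      fix \<pi>
      show "push B B' X \<pi> = 0 \<pi>"
      proof (cases "\<pi> = [b]")
        case True
        have "filter (\<lambda>x. x \<in> B') \<sigma> = [b]" if "\<sigma> \<in> inj_words B" for \<sigma>
        proof -
          have "filter (\<lambda>x. x \<in> B') \<sigma> \<in> inj_words {b}"
            using filter_inj_words[of B' B] that sub b by auto
          then have "length (filter (\<lambda>x. x \<in> B') \<sigma>) = 1" "set (filter (\<lambda>x. x \<in> B') \<sigma>) = {b}"
            using length_inj_words[of _ "{b}"] by (auto simp: inj_words_def)
          then show ?thesis by (cases "filter (\<lambda>x. x \<in> B') \<sigma>") auto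
        qed
        then have "{\<sigma>. \<sigma> \<in> inj_words B \<and> filter (\<lambda>x. x \<in> B') \<sigma> = \<pi>} = inj_words B"
          using True by auto
        then show ?thesis using t by (simp add: push_def)
      next
        case False
        have "\<pi> \<notin> inj_words B'"
        proof
          assume p: "\<pi> \<in> inj_words B'"
          then have "length \<pi> = 1" "set \<pi> = {b}" using length_inj_words[of \<pi> B'] b
            by (auto simp: inj_words_def)
          then show False using False by (cases \<pi>) auto
        qed
        then show ?thesis using push_in_L[of B' B X] sub by (auto simp: L_def)
      qed
    qed
  qed
qed

lemma H_I:
  assumes B: "B \<in> big_subsets0 {1..n}" and L: "X \<in> L (inj_words B)"
    and p: "\<And>B'. B' \<in> big_subsets0 B \<Longrightarrow> B' \<noteq> B \<Longrightarrow> push B B' X = 0"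
  shows "X \<in> H n B"
proof (cases "B = {}")
  case True
  then show ?thesis using L by (simp add: H_def)
next
  case False
  have "marginal n B' X = 0" if "B' \<subset> B" for B'
  proof (cases "2 \<le> card B'")
    case True
    then have "B' \<in> big_subsets0 B" using that by (auto simp: big_subsets0_def big_subsets_def)
    then show ?thesis using p[of B'] marginal_eq_push[OF B _ L] that by auto
  next
    case F: False
    have "{} \<in> big_subsets0 B" by (simp add: big_subsets0_def)
    then have "marginal n {} X = 0" using p[of "{}"] marginal_eq_push[OF B _ L] False by auto
    then show ?thesis using marginal_small[of B' n X] F by simp
  qed
  then show ?thesis using L False by (simp add: H_def)
qed

section \<open>Marginals of synthesised functions\<close>

lemma phi_apply:
  assumes B: "B \<in> big_subsets0 {1..n}" and X: "X \<in> L (inj_words B)"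
  shows "phi n A X \<sigma> = (\<Sum>\<pi>\<in>inj_words B. X \<pi> * phi_dirac A \<pi> \<sigma>)"
  unfolding phi_def using X
  by (intro sum.mono_neutral_right finite_Gamma0 inj_words_subset_Gamma0[OF B])
    (auto simp: L_def)

lemma phi_in_L: "phi n A X \<in> L (inj_words A)"
  by (auto simp: L_def phi_def phi_dirac_def intro!: sum.neutral)

lemma phi_0: "phi n A 0 = 0"
  by (simp add: phi_def fun_eq_iff)

lemma phi_eq_0:
  assumes B: "B \<in> big_subsets0 {1..n}" and X: "X \<in> L (inj_words B)" and "\<not> B \<subseteq> A"
  shows "phi n A X = 0"
proof
  fix \<sigma>
  have "phi_dirac A \<pi> \<sigma> = 0" if "\<pi> \<in> inj_words B" for \<pi>
    using that assms(3) by (auto simp: inj_words_def phi_dirac_def)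
  then show "phi n A X \<sigma> = 0 \<sigma>" by (simp add: phi_apply[OF B X])
qed

lemma sublist_inj_words_eq:
  assumes "\<pi> \<in> inj_words B" "\<sigma> \<in> inj_words B"
  shows "sublist \<pi> \<sigma> \<longleftrightarrow> \<pi> = \<sigma>"
proof
  assume "sublist \<pi> \<sigma>"
  then obtain u v where "\<sigma> = u @ \<pi> @ v" by (auto simp: sublist_def)
  then show "\<pi> = \<sigma>" using length_inj_words[OF assms(1)] length_inj_words[OF assms(2)] by auto
qed auto

lemma phi_self:
  assumes B: "B \<in> big_subsets0 {1..n}" and X: "X \<in> L (inj_words B)"
  shows "phi n B X = X"
proof
  fix \<sigma>
  have k: "phi_dirac B \<pi> \<sigma> = (if \<pi> = \<sigma> then 1 else 0)" if "\<pi> \<in> inj_words B" for \<pi>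
  proof (cases "\<sigma> \<in> inj_words B")
    case True
    show ?thesis
    proof (cases "\<pi> = []")
      case True
      then have "B = {}" using that by (simp add: inj_words_def)
      then show ?thesis using True \<open>\<sigma> \<in> inj_words B\<close> by (simp add: phi_dirac_def)
    next
      case False
      have "set \<pi> \<subseteq> B" using that by (simp add: inj_words_def)
      then show ?thesis
        using False True sublist_inj_words_eq[OF that True] length_inj_words[OF that]
        by (simp add: phi_dirac_def)
    qed
  next
    case False
    then show ?thesis using that by (auto simp: phi_dirac_def)
  qed
  have "phi n B X \<sigma> = (\<Sum>\<pi>\<in>inj_words B. if \<pi> = \<sigma> then X \<pi> else 0)"
    unfolding phi_apply[OF B X] by (intro sum.cong refl) (simp add: k)
  also have "\<dots> = X \<sigma>"
    using X finite_inj_words[OF finite_big_subsets0_member[OF B]] by (auto simp: L_def)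
  finally show "phi n B X \<sigma> = X \<sigma>" .
qed

lemma sum_insertions_phi_dirac:
  assumes A: "finite A" "a \<in> A" and s: "s \<in> inj_words (A - {a})"
    and p: "distinct \<pi>" "set \<pi> \<subseteq> A" "\<pi> \<noteq> []"
  shows "(\<Sum>\<sigma>\<in>insertions a s. phi_dirac A \<pi> \<sigma>)
       = card {\<sigma> \<in> insertions a s. sublist \<pi> \<sigma>} / fact (card A - length \<pi> + 1)"
proof -
  have d: "distinct s" "a \<notin> set s" using s by (auto simp: inj_words_def)
  have "insertions a s \<subseteq> inj_words A"
    using inj_words_removeAll_fibre[OF s A(2)] by blast
  then have "(\<Sum>\<sigma>\<in>insertions a s. phi_dirac A \<pi> \<sigma>)
     = (\<Sum>\<sigma>\<in>insertions a s. if sublist \<pi> \<sigma> then 1 / fact (card A - length \<pi> + 1) else 0)"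
    using p by (intro sum.cong refl) (auto simp: phi_dirac_def)
  also have "\<dots> = card {\<sigma> \<in> insertions a s. sublist \<pi> \<sigma>} / fact (card A - length \<pi> + 1)"
    using finite_insertions[OF d] by (simp add: sum.inter_filter[symmetric])
  finally show ?thesis .
qed

text \<open>
  With \<open>m = card A - 1\<close>, the sum is \<open>(m - length \<pi> + 2) / fact (m - length \<pi> + 2)\<close> for nonempty
  factors \<open>\<pi>\<close> of \<open>s\<close>. For the empty word it is \<open>(m + 1) / fact (m + 1)\<close>, which is why the two
  branches of \<open>phi_dirac\<close> need different normalisations.
\<close>

lemma sum_insertions_phi_dirac_avoiding:
  assumes A: "finite A" "a \<in> A" and s: "s \<in> inj_words (A - {a})"
    and p: "distinct \<pi>" "set \<pi> \<subseteq> A - {a}"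
  shows "(\<Sum>\<sigma>\<in>insertions a s. phi_dirac A \<pi> \<sigma>) = phi_dirac (A - {a}) \<pi> s"
proof -
  have d: "distinct s" "a \<notin> set s" using s by (auto simp: inj_words_def)
  obtain m where m: "card A = Suc m" using A by (metis card_Suc_Diff1)
  then have cs: "card (A - {a}) = m" "length s = m" using A length_inj_words[OF s] by auto
  show ?thesis
  proof (cases "\<pi> = []")
    case True
    have "insertions a s \<subseteq> inj_words A"
      using inj_words_removeAll_fibre[OF s A(2)] by blast
    then have "(\<Sum>\<sigma>\<in>insertions a s. phi_dirac A \<pi> \<sigma>) = (\<Sum>\<sigma>\<in>insertions a s. 1 / fact (card A))"
      using True by (intro sum.cong refl) (auto simp: phi_dirac_def)
    also have "\<dots> = 1 / fact m"
      using card_insertions[OF d] cs m by (simp add: fact_Suc del: of_nat_Suc)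
    finally show ?thesis using True s cs by (simp add: phi_dirac_def)
  next
    case False
    have "length \<pi> \<le> m"
      using p cs A by (metis card_mono distinct_card finite_Diff)
    then have e: "card A - length \<pi> + 1 = Suc (m - length \<pi> + 1)" using m by simp
    have q: "set \<pi> \<subseteq> A" "a \<notin> set \<pi>" using p by auto
    have f: "real (Suc j) / fact (Suc j) = 1 / fact j" for j
      by (simp add: fact_Suc del: of_nat_Suc)
    show ?thesis
      unfolding sum_insertions_phi_dirac[OF A s p(1) q(1) False]
        card_insertions_avoiding_factor[OF d q(2) False] e
      using p False s cs f[of "m - length \<pi> + 1"] by (simp add: phi_dirac_def del: fact_Suc)
  qed
qed

text \<open>
  For \<open>a \<in> B\<close> both sides are zero: the words \<open>\<pi>\<close> with content \<open>B\<close> are grouped by the word \<open>\<rho>\<close>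
  left after erasing \<open>a\<close>, since the weight of \<open>\<pi>\<close> at \<open>s\<close> depends on \<open>\<rho>\<close> only. As \<open>B\<close> is never
  a singleton, \<open>\<rho>\<close> is nonempty.
\<close>

lemma push_phi_delete:
  assumes B: "B \<in> big_subsets0 {1..n}" and X: "X \<in> H n B" and BA: "B \<subseteq> A"
    and A: "finite A" "a \<in> A"
  shows "push A (A - {a}) (phi n A X) = phi n (A - {a}) X"
proof
  fix s
  note XL = H_imp_L[OF X]
  have fB: "finite B" using B by (rule finite_big_subsets0_member)
  show "push A (A - {a}) (phi n A X) s = phi n (A - {a}) X s"
  proof (cases "s \<in> inj_words (A - {a})")
    case False
    then show ?thesis
      using push_in_L[of "A - {a}" A "phi n A X"] phi_in_L[of n "A - {a}" X] by (auto simp: L_def)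
  next
    case s: True
    then have d: "distinct s" "a \<notin> set s" by (auto simp: inj_words_def)
    have "push A (A - {a}) (phi n A X) s = (\<Sum>\<sigma>\<in>insertions a s. phi n A X \<sigma>)"
      unfolding push_def using inj_words_removeAll_fibre[OF s A(2)] by simp
    also have "\<dots> = (\<Sum>\<pi>\<in>inj_words B. X \<pi> * (\<Sum>\<sigma>\<in>insertions a s. phi_dirac A \<pi> \<sigma>))"
      unfolding phi_apply[OF B XL] sum_distrib_left by (rule sum.swap)
    finally have e: "push A (A - {a}) (phi n A X) s
      = (\<Sum>\<pi>\<in>inj_words B. X \<pi> * (\<Sum>\<sigma>\<in>insertions a s. phi_dirac A \<pi> \<sigma>))" .
    show ?thesis
    proof (cases "a \<in> B")
      case False
      then show ?thesis
        unfolding e phi_apply[OF B XL] using BA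
        by (intro sum.cong refl arg_cong2[where f = "(*)"]
            sum_insertions_phi_dirac_avoiding[OF A s]) (auto simp: inj_words_def)
    next
      case True
      let ?c = "1 / fact (card A - card B + 1) :: real"
      have ne: "B - {a} \<noteq> {}"
        using B True fB by (auto simp: big_subsets0_def big_subsets_def subset_singleton_iff)
      have del: "removeAll a \<pi> \<in> inj_words (B - {a})" if "\<pi> \<in> inj_words B" for \<pi>
        using that by (auto simp: inj_words_def distinct_removeAll)
      have "push A (A - {a}) (phi n A X) s
          = (\<Sum>\<pi>\<in>inj_words B. X \<pi> * (if sublist (removeAll a \<pi>) s then ?c else 0))"
        unfolding e
      proof (intro sum.cong refl arg_cong2[where f = "(*)"])
        fix \<pi> assume p: "\<pi> \<in> inj_words B"
        have "set (removeAll a \<pi>) \<noteq> {}"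
          using del[OF p] ne by (simp add: inj_words_def del: set_removeAll)
        then have "removeAll a \<pi> \<noteq> []" by (metis set_empty)
        then have q: "distinct \<pi>" "set \<pi> \<subseteq> A" "\<pi> \<noteq> []" "a \<in> set \<pi>" "removeAll a \<pi> \<noteq> []"
          using p BA True by (auto simp: inj_words_def)
        show "(\<Sum>\<sigma>\<in>insertions a s. phi_dirac A \<pi> \<sigma>) = (if sublist (removeAll a \<pi>) s then ?c else 0)"
          unfolding sum_insertions_phi_dirac[OF A s q(1-3)]
            card_insertions_containing_factor[OF d q(4,1,5)]
          using length_inj_words[OF p] by simp
      qed
      also have "\<dots> = (\<Sum>\<rho>\<in>inj_words (B - {a}). \<Sum>\<pi> | \<pi> \<in> inj_words B \<and> removeAll a \<pi> = \<rho>.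
          X \<pi> * (if sublist (removeAll a \<pi>) s then ?c else 0))"
        using del fB finite_inj_words by (intro sum.group[symmetric]) auto
      also have "\<dots> = (\<Sum>\<rho>\<in>inj_words (B - {a}).
          (if sublist \<rho> s then ?c else 0) * push B (B - {a}) X \<rho>)"
      proof (intro sum.cong refl)
        fix \<rho>
        have fib: "{\<pi>. \<pi> \<in> inj_words B \<and> filter (\<lambda>x. x \<in> B - {a}) \<pi> = \<rho>}
            = {\<pi>. \<pi> \<in> inj_words B \<and> removeAll a \<pi> = \<rho>}"
          by (intro Collect_cong conj_cong refl) (simp only: filter_eq_removeAll)
        show "(\<Sum>\<pi> | \<pi> \<in> inj_words B \<and> removeAll a \<pi> = \<rho>.
          X \<pi> * (if sublist (removeAll a \<pi>) s then ?c else 0))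
          = (if sublist \<rho> s then ?c else 0) * push B (B - {a}) X \<rho>"
          unfolding push_def fib sum_distrib_left by (intro sum.cong refl) auto
      qed
      also have "\<dots> = 0"
      proof -
        have "push B (B - {a}) X = 0" using True by (intro push_H_eq_0[OF B X]) blast
        then show ?thesis by simp
      qed
      finally have "push A (A - {a}) (phi n A X) s = 0" .
      moreover have "phi n (A - {a}) X = 0" using True by (intro phi_eq_0[OF B XL]) blast
      ultimately show ?thesis by simp
    qed
  qed
qed

lemma push_phi:
  assumes B: "B \<in> big_subsets0 {1..n}" and X: "X \<in> H n B" and A: "finite A" "A' \<subseteq> A"
  shows "push A A' (phi n A X) = phi n A' X"
proof -
  \<comment> \<open>Once a letter of \<open>B\<close> has been erased, both sides stay zero.\<close>
  have *: "push A (A - D) (phi n A X) = phi n (A - D) X" if "finite D" "D \<subseteq> A" for D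
    using that
  proof (induction D rule: finite_induct)
    case empty
    then show ?case using push_self[OF phi_in_L] by simp
  next
    case (insert a D)
    let ?C = "A - D"
    have e: "A - insert a D = ?C - {a}" by auto
    have "push A (?C - {a}) (phi n A X) = push ?C (?C - {a}) (push A ?C (phi n A X))"
      using A by (intro push_push[symmetric]) auto
    also have "\<dots> = push ?C (?C - {a}) (phi n ?C X)" using insert by simp
    also have "\<dots> = phi n (?C - {a}) X"
    proof (cases "B \<subseteq> ?C")
      case True
      then show ?thesis using push_phi_delete[OF B X True, of a] A insert by auto
    next
      case False
      then have "\<not> B \<subseteq> ?C - {a}" by blast
      then show ?thesis using False phi_eq_0[OF B H_imp_L[OF X]] push_0 by metis
    qed
    finally show ?case unfolding e .
  qed
  have "A - (A - A') = A'" using A by auto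
  then show ?thesis using *[of "A - A'"] A by auto
qed

section \<open>The wavelet decomposition\<close>

lemma push_sum_phi:
  assumes X: "\<And>C. C \<in> S \<Longrightarrow> C \<in> big_subsets0 {1..n} \<and> X C \<in> H n C"
    and A: "finite A" "A' \<subseteq> A" and S: "finite S" "big_subsets0 A' \<subseteq> S"
  shows "push A A' (\<Sum>C\<in>S. phi n A (X C)) = (\<Sum>C\<in>big_subsets0 A'. phi n A' (X C))"
proof -
  have "push A A' (\<Sum>C\<in>S. phi n A (X C)) = (\<Sum>C\<in>S. phi n A' (X C))"
    unfolding push_sum using X A by (intro sum.cong refl push_phi) auto
  also have "\<dots> = (\<Sum>C\<in>big_subsets0 A'. phi n A' (X C))"
  proof (intro sum.mono_neutral_right S ballI)
    fix C assume C: "C \<in> S - big_subsets0 A'"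
    then have "C \<in> big_subsets0 {1..n}" "X C \<in> H n C" "\<not> C \<subseteq> A'"
      using X[of C] by (auto simp: big_subsets0_def big_subsets_def)
    then show "phi n A' (X C) = 0" using phi_eq_0 H_imp_L by blast
  qed
  finally show ?thesis .
qed

text \<open>
  Taking the marginal on \<open>B\<close> isolates \<open>X B\<close> up to the components on proper subsets of \<open>B\<close>, which
  agree by induction.
\<close>

lemma decomposition_unique:
  assumes A: "A \<in> big_subsets0 {1..n}"
    and X: "X \<in> HH n (big_subsets0 A)" and Y: "Y \<in> HH n (big_subsets0 A)"
    and eq: "(\<Sum>C\<in>big_subsets0 A. phi n A (X C)) = (\<Sum>C\<in>big_subsets0 A. phi n A (Y C))"
  shows "X = Y"
proof -
  have fA: "finite A" using A by (rule finite_big_subsets0_member)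
  have sub: "big_subsets0 A \<subseteq> big_subsets0 {1..n}"
    using big_subsets0_mono big_subsets0_subset[OF A] by blast
  have "X B = Y B" if "finite B" "B \<in> big_subsets0 A" for B
    using that
  proof (induction B rule: finite_psubset_induct)
    case (psubset B)
    have BA: "B \<subseteq> A" using psubset.prems by (rule big_subsets0_subset)
    have Bn: "B \<in> big_subsets0 {1..n}" using psubset.prems sub by blast
    have self: "B \<in> big_subsets0 B"
      using psubset.prems by (auto simp: big_subsets0_def big_subsets_def)
    have fin: "finite (big_subsets0 B)" using psubset.hyps finite_big_subsets0 by blast
    have p: "push A B (\<Sum>C\<in>big_subsets0 A. phi n A (Z C))
        = phi n B (Z B) + (\<Sum>C\<in>big_subsets0 B - {B}. phi n B (Z C))"
      if Z: "Z \<in> HH n (big_subsets0 A)" for Z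
    proof -
      have "push A B (\<Sum>C\<in>big_subsets0 A. phi n A (Z C)) = (\<Sum>C\<in>big_subsets0 B. phi n B (Z C))"
      proof (rule push_sum_phi[OF _ fA BA finite_big_subsets0[OF fA] big_subsets0_mono[OF BA]])
        show "C \<in> big_subsets0 {1..n} \<and> Z C \<in> H n C" if "C \<in> big_subsets0 A" for C
          using that Z sub by (auto simp: HH_def)
      qed
      also have "\<dots> = phi n B (Z B) + (\<Sum>C\<in>big_subsets0 B - {B}. phi n B (Z C))"
        by (rule sum.remove[OF fin self])
      finally show ?thesis .
    qed
    have "(\<Sum>C\<in>big_subsets0 B - {B}. phi n B (X C)) = (\<Sum>C\<in>big_subsets0 B - {B}. phi n B (Y C))"
    proof (intro sum.cong refl)
      fix C assume "C \<in> big_subsets0 B - {B}"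
      then have "C \<subset> B" "C \<in> big_subsets0 A"
        using big_subsets0_subset big_subsets0_mono[OF BA] by auto
      then show "phi n B (X C) = phi n B (Y C)" using psubset.IH by simp
    qed
    then have "phi n B (X B) = phi n B (Y B)" using p[OF X] p[OF Y] eq by simp
    moreover have "X B \<in> L (inj_words B)" "Y B \<in> L (inj_words B)"
      using X Y psubset.prems H_imp_L by (auto simp: HH_def)
    ultimately show ?case using phi_self[OF Bn] by simp
  qed
  moreover have "X B = Y B" if "B \<notin> big_subsets0 A" for B
    using X Y that by (simp add: HH_def)
  ultimately show ?thesis
    using fA big_subsets0_subset finite_subset by (metis ext)
qed

text \<open>
  The equation of the triangular system at \<open>B\<close>, solved for the diagonal term. Finiteness of \<open>B\<close>
  is what makes the cardinality decrease in the recursive calls.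
\<close>

function wavelet :: "nat \<Rightarrow> nat set \<Rightarrow> (nat list \<Rightarrow> real) \<Rightarrow> nat set \<Rightarrow> nat list \<Rightarrow> real" where
  "wavelet n A F B = (if finite B
     then push A B F - (\<Sum>C\<in>big_subsets0 B - {B}. phi n B (wavelet n A F C)) else 0)"
  by pat_completeness auto
termination
  by (relation "measure (\<lambda>(n, A, F, B). card B)")
    (auto dest: big_subsets0_subset intro!: psubset_card_mono)

declare wavelet.simps [simp del]

lemma L_diff: "F \<in> L E \<Longrightarrow> G \<in> L E \<Longrightarrow> F - G \<in> L E"
  by (simp add: L_def)

lemma L_sum: "(\<And>i. i \<in> S \<Longrightarrow> F i \<in> L E) \<Longrightarrow> (\<Sum>i\<in>S. F i) \<in> L E"
  by (auto simp: L_def sum_fun_apply)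

lemma wavelet_in_L:
  assumes "finite B" "B \<subseteq> A"
  shows "wavelet n A F B \<in> L (inj_words B)"
  using assms by (subst wavelet.simps) (auto intro!: L_diff L_sum push_in_L phi_in_L)

lemma push_eq_sum_phi_wavelet:
  assumes A: "A \<in> big_subsets0 {1..n}" and B: "B \<in> big_subsets0 A"
  shows "push A B F = (\<Sum>C\<in>big_subsets0 B. phi n B (wavelet n A F C))"
proof -
  have BA: "B \<subseteq> A" using B by (rule big_subsets0_subset)
  then have fB: "finite B" using finite_big_subsets0_member[OF A] finite_subset by blast
  have Bn: "B \<in> big_subsets0 {1..n}"
    using B big_subsets0_mono[OF big_subsets0_subset[OF A]] by blast
  have self: "B \<in> big_subsets0 B" using B by (auto simp: big_subsets0_def big_subsets_def)
  have "(\<Sum>C\<in>big_subsets0 B. phi n B (wavelet n A F C))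
      = wavelet n A F B + (\<Sum>C\<in>big_subsets0 B - {B}. phi n B (wavelet n A F C))"
    using sum.remove[OF finite_big_subsets0[OF fB] self, of "\<lambda>C. phi n B (wavelet n A F C)"]
      phi_self[OF Bn wavelet_in_L[OF fB BA]] by simp
  also have "\<dots> = push A B F" using fB by (subst wavelet.simps) simp
  finally show ?thesis by simp
qed

text \<open>
  Pushed to \<open>B' \<subset> B\<close>, the recursive equation at \<open>B\<close> becomes the difference of the two sides of
  the equation at \<open>B'\<close>: the components indexed by sets not inside \<open>B'\<close> disappear, being already
  known to lie in their spaces.
\<close>

lemma wavelet_in_H:
  assumes A: "A \<in> big_subsets0 {1..n}" and "finite B" "B \<in> big_subsets0 A"
  shows "wavelet n A F B \<in> H n B"
  using assms(2,3)
proof (induction B rule: finite_psubset_induct)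
  case (psubset B)
  have BA: "B \<subseteq> A" using psubset.prems by (rule big_subsets0_subset)
  have fA: "finite A" using A by (rule finite_big_subsets0_member)
  have sub: "big_subsets0 A \<subseteq> big_subsets0 {1..n}"
    using big_subsets0_mono big_subsets0_subset[OF A] by blast
  show ?case
  proof (rule H_I)
    show "B \<in> big_subsets0 {1..n}" using psubset.prems sub by blast
    show "wavelet n A F B \<in> L (inj_words B)" using psubset.hyps BA by (rule wavelet_in_L)
  next
    fix B' assume B': "B' \<in> big_subsets0 B" "B' \<noteq> B"
    then have B'B: "B' \<subset> B" using big_subsets0_subset by blast
    have B'A: "B' \<in> big_subsets0 A" using B' big_subsets0_mono[OF BA] by blast
    have "push B B' (wavelet n A F B) = push B B' (push A B F)
        - push B B' (\<Sum>C\<in>big_subsets0 B - {B}. phi n B (wavelet n A F C))"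
      using psubset.hyps by (subst wavelet.simps) (simp add: push_diff)
    also have "push B B' (push A B F) = push A B' F"
      using fA B'B BA by (intro push_push) auto
    also have "push B B' (\<Sum>C\<in>big_subsets0 B - {B}. phi n B (wavelet n A F C))
        = (\<Sum>C\<in>big_subsets0 B'. phi n B' (wavelet n A F C))"
    proof (rule push_sum_phi)
      fix C assume "C \<in> big_subsets0 B - {B}"
      then have "C \<subset> B" "C \<in> big_subsets0 A"
        using big_subsets0_subset big_subsets0_mono[OF BA] by auto
      then show "C \<in> big_subsets0 {1..n} \<and> wavelet n A F C \<in> H n C"
        using psubset.IH sub by blast
    next
      show "big_subsets0 B' \<subseteq> big_subsets0 B - {B}"
        using big_subsets0_mono[of B' B] big_subsets0_subset[of B B'] B'B by blast
    qed (use psubset.hyps B'B finite_big_subsets0 in auto)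
    finally show "push B B' (wavelet n A F B) = 0"
      using push_eq_sum_phi_wavelet[OF A B'A, of F] by (simp add: zero_fun_def)
  qed
qed

lemma decomposition_exists:
  assumes A: "A \<in> big_subsets0 {1..n}"
  obtains X where "X \<in> HH n (big_subsets0 A)"
    and "\<And>A'. A' \<in> big_subsets0 A \<Longrightarrow> push A A' F = (\<Sum>C\<in>big_subsets0 A'. phi n A' (X C))"
proof
  let ?X = "\<lambda>B. if B \<in> big_subsets0 A then wavelet n A F B else 0"
  have fin: "finite B" if "B \<in> big_subsets0 A" for B
    using that finite_big_subsets0_member[OF A] big_subsets0_subset finite_subset by blast
  show "?X \<in> HH n (big_subsets0 A)"
    using wavelet_in_H[OF A] fin by (auto simp: HH_def)
  fix A' assume A': "A' \<in> big_subsets0 A"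
  show "push A A' F = (\<Sum>C\<in>big_subsets0 A'. phi n A' (?X C))"
    unfolding push_eq_sum_phi_wavelet[OF A A']
    using big_subsets0_mono[OF big_subsets0_subset[OF A']] by (intro sum.cong refl) auto
qed

text \<open>Uniqueness resolves the description operator.\<close>

lemma Psi_on_eq:
  assumes A: "A \<in> big_subsets0 {1..n}" and X: "X \<in> HH n (big_subsets0 A)"
    and F: "F = (\<Sum>C\<in>big_subsets0 A. phi n A (X C))"
  shows "Psi_on n A F = X"
proof
  fix B
  have "(THE X. X \<in> HH n (big_subsets0 A) \<and> F = (\<Sum>C\<in>big_subsets0 A. phi n A (X C))) = X"
    using decomposition_unique[OF A _ X] X F by (intro the_equality) auto
  then show "Psi_on n A F B = X B" using X by (auto simp: Psi_on_def HH_def)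
qed

lemma zero_in_HH: "0 \<in> HH n S"
  by (auto simp: HH_def H_def L_def marginal_def fun_eq_iff)

lemma Psi_eq:
  assumes A: "A \<in> big_subsets0 {1..n}" and X: "X \<in> HH n (big_subsets0 A)"
    and F: "F = (\<Sum>C\<in>big_subsets0 A. phi n A (X C))"
  shows "Psi n F = X"
proof
  fix B
  have FL: "F \<in> L (inj_words A)" unfolding F by (intro L_sum phi_in_L)
  have r: "restr (inj_words A') F = (if A' = A then F else 0)" for A'
    using FL by (auto simp: restr_def L_def inj_words_def fun_eq_iff)
  have z: "Psi_on n A' 0 = 0" if "A' \<in> big_subsets0 {1..n}" for A'
    by (rule Psi_on_eq[OF that zero_in_HH]) (simp add: phi_0)
  have "Psi n F B = (\<Sum>A'\<in>big_subsets0 {1..n}. if A' = A then X B else 0)"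
    unfolding Psi_def r using z Psi_on_eq[OF A X F] by (intro sum.cong refl) auto
  also have "\<dots> = X B" using A finite_big_subsets0[of "{1..n}"] by simp
  finally show "Psi n F B = X B" .
qed

text \<open>Components indexed by sets not inside \<open>A'\<close> are synthesised to zero.\<close>

lemma phi_fam_eq:
  assumes "A \<in> big_subsets0 {1..n}" "X \<in> HH n (big_subsets0 A)" "A' \<in> big_subsets0 A"
  shows "phi_fam n A' X = (\<Sum>B\<in>big_subsets0 A'. phi n A' (X B))"
  unfolding phi_fam_def
proof (intro sum.mono_neutral_right ballI finite_big_subsets0)
  show "big_subsets0 A' \<subseteq> big_subsets0 {1..n}"
    using assms big_subsets0_subset by (intro big_subsets0_mono) blast
  fix B assume B: "B \<in> big_subsets0 {1..n} - big_subsets0 A'"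
  then have nB: "\<not> B \<subseteq> A'" by (auto simp: big_subsets0_def big_subsets_def)
  show "phi n A' (X B) = 0"
  proof (cases "B \<in> big_subsets0 A")
    case True
    then have "X B \<in> L (inj_words B)" using assms(2) H_imp_L unfolding HH_def by blast
    then show ?thesis using B nB phi_eq_0 by blast
  next
    case False
    then show ?thesis using assms(2) phi_0 by (simp add: HH_def)
  qed
qed simp

theorem theorem5:
  fixes n :: nat and A :: "nat set" and F :: "nat list \<Rightarrow> real"
  assumes "1 \<le> n"
    and "A \<in> big_subsets0 {1..n}"
    and "F \<in> L (inj_words A)"
  shows "(Psi n F \<in> HH n (big_subsets0 A)
          \<and> F = phi_fam n A (Psi n F)
          \<and> phi_fam n A (Psi n F) = (\<Sum>B\<in>big_subsets0 A. phi n A (Psi n F B))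
          \<and> (\<forall>X \<in> HH n (big_subsets0 A). F = phi_fam n A X \<longrightarrow> X = Psi n F))
       \<and> (\<forall>A' \<in> big_subsets0 A.
            marginal n A' F = phi_fam n A' (Psi n F)
          \<and> (\<forall>B \<in> big_subsets0 A'. Psi n (marginal n A' F) B = Psi n F B))"
proof -
  note A = assms(2) and F = assms(3)
  have self: "A \<in> big_subsets0 A" using A by (auto simp: big_subsets0_def big_subsets_def)
  obtain X where X: "X \<in> HH n (big_subsets0 A)"
    and p: "\<And>A'. A' \<in> big_subsets0 A \<Longrightarrow> push A A' F = (\<Sum>C\<in>big_subsets0 A'. phi n A' (X C))"
    using decomposition_exists[OF A, where F = F] by blast
  have FX: "F = (\<Sum>C\<in>big_subsets0 A. phi n A (X C))" using p[OF self] push_self[OF F] by simp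
  have Psi: "Psi n F = X" by (rule Psi_eq[OF A X FX])
  have M: "marginal n A' F = (\<Sum>C\<in>big_subsets0 A'. phi n A' (X C))" if "A' \<in> big_subsets0 A" for A'
    using marginal_eq_push[OF A that F] p[OF that] by simp
  have PM: "Psi n (marginal n A' F) B = X B"
    if A': "A' \<in> big_subsets0 A" and B: "B \<in> big_subsets0 A'" for A' B
  proof -
    \<comment> \<open>The marginal of \<open>F\<close> is synthesised from the same components, cut down to \<open>A'\<close>.\<close>
    let ?Y = "\<lambda>B. if B \<in> big_subsets0 A' then X B else 0"
    have sub: "big_subsets0 A' \<subseteq> big_subsets0 A"
      using big_subsets0_mono[OF big_subsets0_subset[OF A']] .
    have "Psi n (marginal n A' F) = ?Y"
    proof (rule Psi_eq)
      show "A' \<in> big_subsets0 {1..n}"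
        using A' big_subsets0_mono[OF big_subsets0_subset[OF A]] by blast
      show "?Y \<in> HH n (big_subsets0 A')" using X sub by (auto simp: HH_def)
      show "marginal n A' F = (\<Sum>C\<in>big_subsets0 A'. phi n A' (?Y C))"
        unfolding M[OF A'] by (intro sum.cong refl) auto
    qed
    then show ?thesis using B by simp
  qed
  have U: "Z = X" if "Z \<in> HH n (big_subsets0 A)" "F = phi_fam n A Z" for Z
  proof (rule decomposition_unique[OF A that(1) X])
    show "(\<Sum>C\<in>big_subsets0 A. phi n A (Z C)) = (\<Sum>C\<in>big_subsets0 A. phi n A (X C))"
      using that(2) FX phi_fam_eq[OF A that(1) self] by metis
  qed
  show ?thesis
    unfolding Psi
  proof (intro conjI ballI impI)
    show "F = phi_fam n A X" using FX phi_fam_eq[OF A X self] by (rule trans[OF _ sym])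
    show "marginal n A' F = phi_fam n A' X" if "A' \<in> big_subsets0 A" for A'
      using M[OF that] phi_fam_eq[OF A X that] by (rule trans[OF _ sym])
    show "Z = X" if "Z \<in> HH n (big_subsets0 A)" "F = phi_fam n A Z" for Z
      using that by (rule U)
    show "Psi n (marginal n A' F) B = X B" if "A' \<in> big_subsets0 A" "B \<in> big_subsets0 A'" for A' B
      using that by (rule PM)
  qed (use X phi_fam_eq[OF A X self] in blast)+
qed

end
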